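(* The action of $\mathbb N\rtimes\mathbb N^\times$ on the space $(\bar{\mathbb N}\times\hat{\mathbb Z}/\hat{\mathbb Z}^* )/_\sim=\{(r,a): a\in\hat{\mathbb Z}/\hat{\mathbb Z}^*\text{ and } r\in\bar{\mathbb N}_a\}$ obtained through the bijection $\tilde p$ from the action on $\Omega$ is given by $$(m,k)(r,a)=(m+kr,ka)\quad\text{for } (m,k)\in\mathbb N\rtimes\mathbb N^\times.$$
   Context: Notation: $\mathbb N=\{0,1,2,\dots\}$, $\mathbb N^\times=\mathbb N\setminus\{0\}$ (multiplicative semigroup), and $\mathbb N\rtimes\mathbb N^\times$ is the semidirect product with $(m,k)(n,l)=(m+kn,kl)$, a subsemigroup of the group $\mathbb Q\rtimes\mathbb Q^*_+$. It is partially ordered by $x\le y$ iff $x^{-1}y\in\mathbb N\rtimes\mathbb N^\times$. The Nica spectrum $\Omega$ is the set of nonempty hereditary directed subsets $\omega\subset\mathbb N\rtimes\mathbb N^\times$ (hereditary: $y\in\omega$, $x\le y$ imply $x\in\omega$; directed: any two elements of $\omega$ have a common upper bound in $\omega$). The action of $x\in\mathbb N\rtimes\mathbb N^\times$ on $\Omega$ sends $\omega$ to the smallest hereditary directed set containing $\{xy: y\in\omega\}$. $\hat{\mathbb Z}=\prod_p\mathbb Z_p$ (over all primes), $\hat{\mathbb Z}^*=\prod_p\mathbb Z_p^*$ acts on it by multiplication, with orbit space $\hat{\mathbb Z}/\hat{\mathbb Z}^*$. $\bar{\mathbb N}=\mathbb N\sqcup\hat{\mathbb Z}$ (disjoint union).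 For $a\in\hat{\mathbb Z}/\hat{\mathbb Z}^*$ the ideal $a\hat{\mathbb Z}$ is well defined, and $\bar{\mathbb N}_a=\mathbb N\sqcup(\hat{\mathbb Z}/a\hat{\mathbb Z})$. The relation $\sim$ on $\bar{\mathbb N}\times\hat{\mathbb Z}/\hat{\mathbb Z}^*$ identifies $(r,a)$ and $(r',a')$ with $r,r'\in\hat{\mathbb Z}$ iff $a=a'$ and $r-r'\in a\hat{\mathbb Z}$ (points with $r\in\mathbb N$ are identified only with themselves). The bijection $\tilde p\colon(\bar{\mathbb N}\times\hat{\mathbb Z}/\hat{\mathbb Z}^* )/_\sim\to\Omega$ is given by: if $r\in\mathbb N$, then $\tilde p(r,a)=\{(m,k)\in\mathbb N\rtimes\mathbb N^\times: a\in k\hat{\mathbb Z}/\hat{\mathbb Z}^*,\ r-m\in k\mathbb N\}$; if $r\in\hat{\mathbb Z}/a\hat{\mathbb Z}$, then $\tilde p(r,a)=\{(m,k)\in\mathbb N\rtimes\mathbb N^\times: a\in k\hat{\mathbb Z}/\hat{\mathbb Z}^*,\ r-m\in k\hat{\mathbb Z}\}$ (the last condition makes sense since $a\hat{\mathbb Z}\subset k\hat{\mathbb Z}$). Meaning of $m+kr$: for $m\in\mathbb N$ and $r\in\bar{\mathbb N}_a$, $m+r\in\bar{\mathbb N}_a$ is ordinary addition if $r\in\mathbb N$ and translation by the image of $m$ in $\hat{\mathbb Z}/a\hat{\mathbb Z}$ if $r\in\hat{\mathbb Z}/a\hat{\mathbb Z}$. For $k\in\mathbb N^\times$ and $r\in\bar{\mathbb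 N}_a$, $kr\in\bar{\mathbb N}_{ka}$ is ordinary multiplication if $r\in\mathbb N$, and the image of $r$ under the homomorphism $\hat{\mathbb Z}/a\hat{\mathbb Z}\to k\hat{\mathbb Z}/ka\hat{\mathbb Z}\subset\hat{\mathbb Z}/ka\hat{\mathbb Z}$ induced by multiplication by $k$ if $r\in\hat{\mathbb Z}/a\hat{\mathbb Z}$. *)

theory Defs
  imports
    Complex_Main
    "HOL-Algebra.Group"
    "HOL-Library.FuncSet"
    "HOL-Computational_Algebra.Primes"
begin

definition semidirect :: "'a::comm_semiring_1 set \<Rightarrow> ('a \<times> 'a) monoid" where
  "semidirect K = \<lparr>carrier = UNIV \<times> K,
     monoid.mult = (\<lambda>(m, k) (n, l). (m + k * n, k * l)), one = (0, 1)\<rparr>"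

abbreviation NN :: "(nat \<times> nat) monoid" where
  "NN \<equiv> semidirect {k. k \<noteq> 0}"

abbreviation QQ :: "(rat \<times> rat) monoid" where
  "QQ \<equiv> semidirect {q. 0 < q}"

definition NN_to_QQ :: "nat \<times> nat \<Rightarrow> rat \<times> rat" where
  "NN_to_QQ = map_prod of_nat of_nat"

definition NN_le :: "nat \<times> nat \<Rightarrow> nat \<times> nat \<Rightarrow> bool" where
  "NN_le x y \<longleftrightarrow> inv\<^bsub>QQ\<^esub> (NN_to_QQ x) \<otimes>\<^bsub>QQ\<^esub> NN_to_QQ y \<in> NN_to_QQ ` carrier NN"

definition hereditary :: "(nat \<times> nat) set \<Rightarrow> bool" where
  "hereditary w \<longleftrightarrow> (\<forall>y\<in>w. \<forall>x\<in>carrier NN. NN_le x y \<longrightarrow> x \<in> w)"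

definition directed :: "(nat \<times> nat) set \<Rightarrow> bool" where
  "directed w \<longleftrightarrow> (\<forall>x\<in>w. \<forall>y\<in>w. \<exists>z\<in>w. NN_le x z \<and> NN_le y z)"

definition nica_spectrum :: "(nat \<times> nat) set set" where
  "nica_spectrum = {w. w \<subseteq> carrier NN \<and> w \<noteq> {} \<and> hereditary w \<and> directed w}"

definition nica_act :: "nat \<times> nat \<Rightarrow> (nat \<times> nat) set \<Rightarrow> (nat \<times> nat) set" where
  "nica_act x w = (LEAST v. v \<in> nica_spectrum \<and> {x \<otimes>\<^bsub>NN\<^esub> y |y. y \<in> w} \<subseteq> v)"

text \<open>The $p$-adic integers are the inverse limit of the rings $\mathbb{Z}/p^n$: a point is
  the sequence of its residues, each represented in the interval from $0$ to $p^n - 1$.\<close>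

definition padic_ints :: "nat \<Rightarrow> (nat \<Rightarrow> int) set" where
  "padic_ints p = {x. \<forall>n. x n \<in> {0..<int p ^ n} \<and> x (Suc n) mod int p ^ n = x n}"

definition padic_of_int :: "nat \<Rightarrow> int \<Rightarrow> nat \<Rightarrow> int" where
  "padic_of_int p c = (\<lambda>n. c mod int p ^ n)"

definition padic_add :: "nat \<Rightarrow> (nat \<Rightarrow> int) \<Rightarrow> (nat \<Rightarrow> int) \<Rightarrow> nat \<Rightarrow> int" where
  "padic_add p x y = (\<lambda>n. (x n + y n) mod int p ^ n)"

definition padic_mult :: "nat \<Rightarrow> (nat \<Rightarrow> int) \<Rightarrow> (nat \<Rightarrow> int) \<Rightarrow> nat \<Rightarrow> int" where
  "padic_mult p x y = (\<lambda>n. (x n * y n) mod int p ^ n)"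

definition padic_uminus :: "nat \<Rightarrow> (nat \<Rightarrow> int) \<Rightarrow> nat \<Rightarrow> int" where
  "padic_uminus p x = (\<lambda>n. (- x n) mod int p ^ n)"

definition padic_units :: "nat \<Rightarrow> (nat \<Rightarrow> int) set" where
  "padic_units p =
     {x \<in> padic_ints p. \<exists>y\<in>padic_ints p. padic_mult p x y = padic_of_int p 1}"

lemma padic_intsD:
  assumes "x \<in> padic_ints p"
  shows "0 \<le> x n" "x n < int p ^ n" "x (Suc n) mod int p ^ n = x n" "x n mod int p ^ n = x n"
  using assms by (auto simp: padic_ints_def)

lemma padic_intsI:
  assumes "prime p" and "\<And>n. f (Suc n) mod int p ^ n = f n mod int p ^ n"
  shows "(\<lambda>n. f n mod int p ^ n) \<in> padic_ints p"
proof -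
  have "int p ^ n > 0" for n
    using assms(1) prime_gt_0_nat by simp
  moreover have "f (Suc n) mod int p ^ Suc n mod int p ^ n = f n mod int p ^ n" for n
    using assms(2)[of n] by (metis dvd_triv_right mod_mod_cancel power_Suc)
  ultimately show ?thesis
    by (simp add: padic_ints_def)
qed

lemma padic_of_int_closed: "prime p \<Longrightarrow> padic_of_int p c \<in> padic_ints p"
  unfolding padic_of_int_def by (rule padic_intsI) simp_all

lemma padic_add_closed:
  assumes "prime p" "x \<in> padic_ints p" "y \<in> padic_ints p"
  shows "padic_add p x y \<in> padic_ints p"
  unfolding padic_add_def
  by (rule padic_intsI[OF assms(1)]) (metis assms(2,3) mod_add_eq padic_intsD(3))

lemma padic_mult_closed:
  assumes "prime p" "x \<in> padic_ints p" "y \<in> padic_ints p"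
  shows "padic_mult p x y \<in> padic_ints p"
  unfolding padic_mult_def
  by (rule padic_intsI[OF assms(1)]) (metis assms(2,3) mod_mult_eq padic_intsD(3))

lemma padic_uminus_closed:
  assumes "prime p" "x \<in> padic_ints p"
  shows "padic_uminus p x \<in> padic_ints p"
  unfolding padic_uminus_def
  by (rule padic_intsI[OF assms(1)]) (metis assms(2) mod_minus_eq padic_intsD(3))

typedef zhat = "\<Pi>\<^sub>E p\<in>{p::nat. prime p}. padic_ints p"
  morphisms zhat_comp Abs_zhat
proof
  show "(\<lambda>p\<in>{p. prime p}. padic_of_int p 0) \<in> (\<Pi>\<^sub>E p\<in>{p. prime p}. padic_ints p)"
    by (simp add: padic_of_int_closed)
qed

setup_lifting type_definition_zhat

lemma zhat_comp_closed: "prime p \<Longrightarrow> zhat_comp x p \<in> padic_ints p"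
  using zhat_comp[of x] by (auto simp: PiE_iff)

lemma zhat_eqI:
  assumes "\<And>p. prime p \<Longrightarrow> zhat_comp x p = zhat_comp y p"
  shows "x = y"
proof -
  have "zhat_comp x = zhat_comp y"
    using zhat_comp[of x] zhat_comp[of y] assms by (intro PiE_ext) auto
  then show ?thesis by (simp add: zhat_comp_inject)
qed

instantiation zhat :: comm_ring_1
begin

lift_definition zero_zhat :: zhat is "\<lambda>p\<in>{p. prime p}. padic_of_int p 0"
  by (simp add: padic_of_int_closed)

lift_definition one_zhat :: zhat is "\<lambda>p\<in>{p. prime p}. padic_of_int p 1"
  by (simp add: padic_of_int_closed)

lift_definition plus_zhat :: "zhat \<Rightarrow> zhat \<Rightarrow> zhat" is
  "\<lambda>x y. \<lambda>p\<in>{p. prime p}. padic_add p (x p) (y p)"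
  by (simp add: PiE_iff padic_add_closed)

lift_definition times_zhat :: "zhat \<Rightarrow> zhat \<Rightarrow> zhat" is
  "\<lambda>x y. \<lambda>p\<in>{p. prime p}. padic_mult p (x p) (y p)"
  by (simp add: PiE_iff padic_mult_closed)

lift_definition uminus_zhat :: "zhat \<Rightarrow> zhat" is
  "\<lambda>x. \<lambda>p\<in>{p. prime p}. padic_uminus p (x p)"
  by (simp add: PiE_iff padic_uminus_closed)

definition minus_zhat :: "zhat \<Rightarrow> zhat \<Rightarrow> zhat" where
  "minus_zhat x y = x + - y"

instance
proof
  note comps = plus_zhat.rep_eq times_zhat.rep_eq zero_zhat.rep_eq one_zhat.rep_eq
    uminus_zhat.rep_eq padic_add_def padic_mult_def padic_of_int_def padic_uminus_def
  fix a b c :: zhat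
  show "a + b + c = a + (b + c)"
    by (rule zhat_eqI) (simp add: comps mod_simps add.assoc)
  show "a + b = b + a"
    by (rule zhat_eqI) (simp add: comps add.commute)
  show "0 + a = a"
    by (rule zhat_eqI) (simp add: comps padic_intsD(4) zhat_comp_closed)
  show "- a + a = 0"
    by (rule zhat_eqI) (simp add: comps mod_simps)
  show "a - b = a + - b"
    by (simp add: minus_zhat_def)
  show "a * b * c = a * (b * c)"
    by (rule zhat_eqI) (simp add: comps mod_simps mult.assoc)
  show "a * b = b * a"
    by (rule zhat_eqI) (simp add: comps mult.commute)
  show "1 * a = a"
    by (rule zhat_eqI) (simp add: comps mod_simps padic_intsD(4) zhat_comp_closed)
  show "(a + b) * c = a * c + b * c"
    by (rule zhat_eqI) (simp add: comps mod_simps distrib_right)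
  show "(0::zhat) \<noteq> 1"
  proof
    assume "(0::zhat) = 1"
    then have "zhat_comp 0 2 1 = zhat_comp 1 2 1" by simp
    then show False by (simp add: comps)
  qed
qed

end

definition zhat_units :: "zhat set" where
  "zhat_units = {u. \<forall>p. prime p \<longrightarrow> zhat_comp u p \<in> padic_units p}"

lemma zhat_units_iff: "u \<in> zhat_units \<longleftrightarrow> u dvd 1"
proof
  assume "u \<in> zhat_units"
  then have "\<forall>p. prime p \<longrightarrow>
      (\<exists>y. y \<in> padic_ints p \<and> padic_mult p (zhat_comp u p) y = padic_of_int p 1)"
    by (auto simp: zhat_units_def padic_units_def)
  then obtain v where v: "\<And>p. prime p \<Longrightarrow> v p \<in> padic_ints p"
    "\<And>p. prime p \<Longrightarrow> padic_mult p (zhat_comp u p) (v p) = padic_of_int p 1"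
    by metis
  have comp: "zhat_comp (Abs_zhat (\<lambda>p\<in>{p. prime p}. v p)) = (\<lambda>p\<in>{p. prime p}. v p)"
    by (rule Abs_zhat_inverse) (simp add: v)
  have "1 = u * Abs_zhat (\<lambda>p\<in>{p. prime p}. v p)"
    by (rule zhat_eqI) (simp add: one_zhat.rep_eq times_zhat.rep_eq comp v)
  then show "u dvd 1" ..
next
  assume "u dvd 1"
  then obtain v where v: "1 = u * v" ..
  show "u \<in> zhat_units"
    unfolding zhat_units_def padic_units_def
  proof (intro CollectI allI impI conjI bexI)
    fix p :: nat assume p: "prime p"
    show "zhat_comp u p \<in> padic_ints p" "zhat_comp v p \<in> padic_ints p"
      using p by (simp_all add: zhat_comp_closed)
    have "zhat_comp 1 p = zhat_comp (u * v) p" using v by simp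
    then show "padic_mult p (zhat_comp u p) (zhat_comp v p) = padic_of_int p 1"
      using p by (simp add: one_zhat.rep_eq times_zhat.rep_eq)
  qed
qed

definition zhat_ideal :: "zhat \<Rightarrow> zhat set" where
  "zhat_ideal a = {a * z |z. True}"

definition zhat_quot :: "zhat set \<Rightarrow> zhat set set" where
  "zhat_quot I = UNIV // {(r, s). r - s \<in> I}"

definition zhat_orbit_rel :: "zhat \<Rightarrow> zhat \<Rightarrow> bool" where
  "zhat_orbit_rel a b \<longleftrightarrow> (\<exists>u\<in>zhat_units. b = u * a)"

quotient_type zhat_orbit = zhat / zhat_orbit_rel
  morphisms rep_orbit orbit_of
proof (rule equivpI)
  show "reflp zhat_orbit_rel"
    by (rule reflpI) (auto simp: zhat_orbit_rel_def zhat_units_iff intro: bexI[of _ 1])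
  show "symp zhat_orbit_rel"
  proof (rule sympI)
    fix a b assume "zhat_orbit_rel a b"
    then obtain u where u: "b = u * a" "u dvd 1"
      by (auto simp: zhat_orbit_rel_def zhat_units_iff)
    moreover obtain v where "1 = u * v"
      using u(2) by (rule dvdE)
    ultimately
    have "a = v * b" "v dvd 1"
      by (metis mult.assoc mult.commute mult_1, metis dvd_triv_right)
    then show "zhat_orbit_rel b a"
      by (auto simp: zhat_orbit_rel_def zhat_units_iff)
  qed
  show "transp zhat_orbit_rel"
  proof (rule transpI)
    fix a b c assume "zhat_orbit_rel a b" "zhat_orbit_rel b c"
    then obtain u v where "b = u * a" "c = v * b" "u dvd 1" "v dvd 1"
      by (auto simp: zhat_orbit_rel_def zhat_units_iff)
    then have "c = (v * u) * a" "v * u \<in> zhat_units"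
      using mult_dvd_mono[of v 1 u 1] by (auto simp: mult.assoc zhat_units_iff)
    then show "zhat_orbit_rel a c"
      unfolding zhat_orbit_rel_def by (rule bexI)
  qed
qed

lift_definition orbit_ideal :: "zhat_orbit \<Rightarrow> zhat set" is zhat_ideal
proof -
  have sub: "zhat_ideal b \<subseteq> zhat_ideal a" if "zhat_orbit_rel a b" for a b
    using that unfolding zhat_orbit_rel_def zhat_ideal_def
    by clarsimp (metis mult.assoc mult.commute)
  fix a b assume "zhat_orbit_rel a b"
  then show "zhat_ideal a = zhat_ideal b"
    using sub equivp_symp[OF zhat_orbit_equivp] by blast
qed

lift_definition orbit_scale :: "nat \<Rightarrow> zhat_orbit \<Rightarrow> zhat_orbit" is
  "\<lambda>k a. of_nat k * a"
  by (auto simp: zhat_orbit_rel_def ac_simps)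

definition Nbar_at :: "zhat_orbit \<Rightarrow> (nat + zhat set) set" where
  "Nbar_at a = UNIV <+> zhat_quot (orbit_ideal a)"

definition Nbar_space :: "((nat + zhat set) \<times> zhat_orbit) set" where
  "Nbar_space = {(r, a). r \<in> Nbar_at a}"

fun Nbar_sim :: "(nat + zhat) \<times> zhat_orbit \<Rightarrow> (nat + zhat) \<times> zhat_orbit \<Rightarrow> bool" where
  "Nbar_sim (Inl n, a) (Inl n', a') \<longleftrightarrow> n = n' \<and> a = a'"
| "Nbar_sim (Inr r, a) (Inr r', a') \<longleftrightarrow> a = a' \<and> r - r' \<in> orbit_ideal a"
| "Nbar_sim (Inl n, a) (Inr r', a') \<longleftrightarrow> False"
| "Nbar_sim (Inr r, a) (Inl n', a') \<longleftrightarrow> False"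

text \<open>The set \<^const>\<open>Nbar_space\<close> is the quotient by \<^const>\<open>Nbar_sim\<close>: the following map is
  onto it (\<open>range_Nbar_proj\<close>), and its fibres are the equivalence classes
  (\<open>Nbar_proj_eq_iff\<close>).\<close>

definition Nbar_proj :: "(nat + zhat) \<times> zhat_orbit \<Rightarrow> (nat + zhat set) \<times> zhat_orbit" where
  "Nbar_proj = (\<lambda>(r, a). (map_sum id (\<lambda>s. (+) s ` orbit_ideal a) r, a))"

text \<open>Translation of a coset by \<open>m\<close>, and the homomorphism of quotients induced by
  multiplication by \<open>k\<close>, are the elementwise images: the image of the coset of \<open>s\<close> modulo
  \<open>a\<close> under multiplication by \<open>k\<close> is exactly the coset of \<open>k s\<close> modulo \<open>k a\<close>
  (\<open>Nbar_add_coset\<close>, \<open>Nbar_scale_coset\<close>).\<close>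

fun Nbar_add :: "nat \<Rightarrow> nat + zhat set \<Rightarrow> nat + zhat set" where
  "Nbar_add m (Inl n) = Inl (m + n)"
| "Nbar_add m (Inr r) = Inr ((\<lambda>s. of_nat m + s) ` r)"

fun Nbar_scale :: "nat \<Rightarrow> nat + zhat set \<Rightarrow> nat + zhat set" where
  "Nbar_scale k (Inl n) = Inl (k * n)"
| "Nbar_scale k (Inr r) = Inr ((\<lambda>s. of_nat k * s) ` r)"

text \<open>For a coset \<open>r\<close> modulo \<open>a\<close> and \<open>k\<close> dividing \<open>a\<close>, the difference \<open>r - m\<close> is a coset
  contained in a single coset modulo \<open>k\<close>; it lies in the ideal of \<open>k\<close> iff all of its
  elements do.\<close>

fun ptilde :: "(nat + zhat set) \<times> zhat_orbit \<Rightarrow> (nat \<times> nat) set" where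
  "ptilde (Inl r, a) = {(m, k) \<in> carrier NN. a \<in> orbit_of ` zhat_ideal (of_nat k) \<and>
     (\<exists>j::nat. int r - int m = int k * int j)}"
| "ptilde (Inr r, a) = {(m, k) \<in> carrier NN. a \<in> orbit_of ` zhat_ideal (of_nat k) \<and>
     (\<lambda>s. s - of_nat m) ` r \<subseteq> zhat_ideal (of_nat k)}"

definition Nbar_act ::
  "nat \<times> nat \<Rightarrow> (nat + zhat set) \<times> zhat_orbit \<Rightarrow> (nat + zhat set) \<times> zhat_orbit" where
  "Nbar_act x z = the_inv_into Nbar_space ptilde (nica_act x (ptilde z))"

lemma zero_in_zhat_ideal: "0 \<in> zhat_ideal a"
  unfolding zhat_ideal_def by (force intro: exI[of _ 0])

lemma zhat_ideal_add: "x \<in> zhat_ideal a \<Longrightarrow> y \<in> zhat_ideal a \<Longrightarrow> x + y \<in> zhat_ideal a"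
  unfolding zhat_ideal_def by (auto simp flip: distrib_left)

lemma zhat_ideal_uminus: "x \<in> zhat_ideal a \<Longrightarrow> - x \<in> zhat_ideal a"
  unfolding zhat_ideal_def by (auto simp flip: mult_minus_right)

lemma orbit_ideal_obtain:
  obtains b where "orbit_ideal a = zhat_ideal b" "a = orbit_of b"
proof -
  have "a = orbit_of (rep_orbit a)"
    by (simp add: Quotient3_abs_rep[OF Quotient3_zhat_orbit])
  then show ?thesis
    using that orbit_ideal.abs_eq by metis
qed

lemma zhat_coset_eq:
  "{(r, s). r - s \<in> zhat_ideal b} `` {s} = (+) s ` zhat_ideal b"
proof (intro Set.set_eqI iffI)
  fix x assume "x \<in> {(r, s). r - s \<in> zhat_ideal b} `` {s}"
  then have "- (s - x) \<in> zhat_ideal b" by (intro zhat_ideal_uminus) simp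
  then show "x \<in> (+) s ` zhat_ideal b" by (intro image_eqI[of _ _ "- (s - x)"]) simp_all
next
  fix x assume "x \<in> (+) s ` zhat_ideal b"
  then obtain i where "x = s + i" "- i \<in> zhat_ideal b"
    using zhat_ideal_uminus by auto
  then show "x \<in> {(r, s). r - s \<in> zhat_ideal b} `` {s}" by simp
qed

lemma zhat_quot_eq:
  "zhat_quot (orbit_ideal a) = range (\<lambda>s. (+) s ` orbit_ideal a)"
proof -
  obtain b where "orbit_ideal a = zhat_ideal b"
    by (rule orbit_ideal_obtain)
  then show ?thesis
    unfolding zhat_quot_def quotient_def by (simp only: UNION_singleton_eq_range zhat_coset_eq)
qed

lemma zhat_coset_eq_iff:
  "(+) r ` orbit_ideal a = (+) s ` orbit_ideal a \<longleftrightarrow> r - s \<in> orbit_ideal a"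
proof -
  obtain b where b: "orbit_ideal a = zhat_ideal b"
    by (rule orbit_ideal_obtain)
  have sub: "(+) x ` zhat_ideal b \<subseteq> (+) y ` zhat_ideal b" if "x - y \<in> zhat_ideal b" for x y
  proof
    fix z assume "z \<in> (+) x ` zhat_ideal b"
    then obtain i where "i \<in> zhat_ideal b" "z = y + ((x - y) + i)" by auto
    then show "z \<in> (+) y ` zhat_ideal b"
      using that by (blast intro: zhat_ideal_add)
  qed
  show ?thesis unfolding b
  proof
    assume eq: "(+) r ` zhat_ideal b = (+) s ` zhat_ideal b"
    have "r \<in> (+) r ` zhat_ideal b"
      using zero_in_zhat_ideal by (force intro: image_eqI[of _ _ 0])
    then show "r - s \<in> zhat_ideal b" unfolding eq by auto
  next
    assume *: "r - s \<in> zhat_ideal b"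
    then have "s - r \<in> zhat_ideal b" using zhat_ideal_uminus[OF *] by simp
    with * show "(+) r ` zhat_ideal b = (+) s ` zhat_ideal b"
      using sub by blast
  qed
qed

lemma range_Nbar_proj: "range Nbar_proj = Nbar_space"
proof (intro Set.set_eqI iffI)
  fix z assume "z \<in> range Nbar_proj"
  then obtain r a where "z = Nbar_proj (r, a)" by auto
  then show "z \<in> Nbar_space"
    by (cases r) (auto simp: Nbar_proj_def Nbar_space_def Nbar_at_def zhat_quot_eq)
next
  fix z assume "z \<in> Nbar_space"
  then obtain r a where z: "z = (r, a)" "r \<in> Nbar_at a" by (auto simp: Nbar_space_def)
  then consider n where "z = Nbar_proj (Inl n, a)" | s where "z = Nbar_proj (Inr s, a)"
    by (auto simp: Nbar_at_def zhat_quot_eq Nbar_proj_def)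
  then show "z \<in> range Nbar_proj" by cases auto
qed

lemma Nbar_proj_eq_iff: "Nbar_proj x = Nbar_proj y \<longleftrightarrow> Nbar_sim x y"
proof -
  obtain r a s b where "x = (r, a)" "y = (s, b)" using surj_pair by metis
  then show ?thesis
    by (cases r; cases s; cases "a = b") (simp_all add: Nbar_proj_def zhat_coset_eq_iff)
qed

lemma Nbar_add_coset:
  "Nbar_add m (Inr ((+) s ` orbit_ideal a)) = Inr ((+) (of_nat m + s) ` orbit_ideal a)"
  by (simp add: image_image add.assoc)

lemma orbit_ideal_scale:
  "orbit_ideal (orbit_scale k a) = (\<lambda>z. of_nat k * z) ` orbit_ideal a"
  by transfer (auto simp: zhat_ideal_def mult.assoc)

lemma Nbar_scale_coset:
  "Nbar_scale k (Inr ((+) s ` orbit_ideal a)) =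
     Inr ((+) (of_nat k * s) ` orbit_ideal (orbit_scale k a))"
  by (simp add: orbit_ideal_scale image_image distrib_left)

lemma Nbar_add_closed:
  assumes "r \<in> Nbar_at a"
  shows "Nbar_add m r \<in> Nbar_at a"
proof -
  from assms consider n where "r = Inl n" | s where "r = Inr ((+) s ` orbit_ideal a)"
    by (auto simp: Nbar_at_def zhat_quot_eq)
  then show ?thesis
    by cases (simp_all only: Nbar_at_def zhat_quot_eq Nbar_add_coset Nbar_add.simps(1),
      blast+)
qed

lemma Nbar_scale_closed:
  assumes "r \<in> Nbar_at a"
  shows "Nbar_scale k r \<in> Nbar_at (orbit_scale k a)"
proof -
  from assms consider n where "r = Inl n" | s where "r = Inr ((+) s ` orbit_ideal a)"
    by (auto simp: Nbar_at_def zhat_quot_eq)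
  then show ?thesis
    by cases (simp_all only: Nbar_at_def zhat_quot_eq Nbar_scale_coset Nbar_scale.simps(1),
      blast+)
qed

end

theory Submission
  imports Defs "HOL-Number_Theory.Cong"
begin

text \<open>Divisibility by a natural number in \<^typ>\<open>zhat\<close> behaves as in the integers: the ring has no
  \<open>\<nat>\<close>-torsion, and its elements are approximated modulo \<open>k\<close> by arbitrarily large natural
  numbers; moreover every principal ideal is the intersection of the ideals of the natural numbers
  containing it. The last fact shows that \<^const>\<open>ptilde\<close> is injective. Multiplication by
  \<open>(m, k)\<close> maps \<open>ptilde (r, a)\<close> into \<open>ptilde (m + k r, k a)\<close>; conversely, for \<open>(n, l)\<close> in the
  latter set take \<open>j = l / gcd(l, k)\<close>, which divides \<open>a\<close>, and \<open>n' = r\<close> if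
  \<open>r \<in> \<nat>\<close>, else a large \<open>n'\<close> congruent to \<open>r\<close> modulo \<open>j\<close>: then \<open>(n, l) \<le> (m, k)(n', j)\<close>. So the
  second set is the hereditary closure of the image of the first.\<close>

section \<open>The p-adic integers: residues, inverses and division by \<open>p\<close>\<close>

lemma padic_residue:
  assumes "x \<in> padic_ints p" "m \<le> n"
  shows "x n mod int p ^ m = x m"
  using assms(2)
proof (induction n rule: dec_induct)
  case base
  show ?case by (rule padic_intsD(4)[OF assms(1)])
next
  case (step n)
  have "x (Suc n) mod int p ^ m = x (Suc n) mod int p ^ n mod int p ^ m"
    using step.hyps by (simp add: mod_mod_cancel le_imp_power_dvd)
  then show ?case
    using step.IH padic_intsD(3)[OF assms(1)] by simp
qed

lemma padic_zero: "x \<in> padic_ints p \<Longrightarrow> x 0 = 0"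
  using padic_intsD(1,2)[of x p 0] by simp

lemma padic_eq_zero_mono:
  assumes "x \<in> padic_ints p" "x n = 0" "m \<le> n"
  shows "x m = 0"
  using padic_residue[OF assms(1,3)] assms(2) by simp

text \<open>A nonzero residue modulo \<open>p\<close> makes each \<open>x n\<close> coprime to
  \<open>p ^ n\<close>. Inverses modulo \<open>p ^ n\<close> are unique because \<open>x n\<close>
  can be cancelled, so those chosen at different levels are compatible.\<close>

lemma padic_inverse:
  assumes p: "prime p" and x: "x \<in> padic_ints p" and x1: "x 1 \<noteq> 0"
  shows "\<exists>y\<in>padic_ints p. padic_mult p x y = padic_of_int p 1"
proof -
  have cop: "coprime (x n) (int p ^ n)" for n
  proof (cases "n = 0")
    case False
    then have "x n mod int p = x 1"
      using padic_residue[OF x, of 1 n] by simp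
    then have "\<not> int p dvd x n"
      using x1 by auto
    then show ?thesis
      using p by (metis coprime_commute coprime_power_right_iff prime_imp_coprime_int
          prime_nat_int_transfer)
  qed simp
  then have "\<forall>n. \<exists>z. [x n * z = 1] (mod int p ^ n)"
    using cong_solve_coprime_int by blast
  then obtain f where f: "[x n * f n = 1] (mod int p ^ n)" for n
    by metis
  have "f (Suc n) mod int p ^ n = f n mod int p ^ n" for n
  proof -
    have "[x n = x (Suc n)] (mod int p ^ n)"
      using padic_intsD(3,4)[OF x, of n] by (simp add: cong_def)
    then have "[x n * f (Suc n) = x (Suc n) * f (Suc n)] (mod int p ^ n)"
      by (rule cong_mult) simp
    also have "[x (Suc n) * f (Suc n) = 1] (mod int p ^ n)"
      using f[of "Suc n"] by (rule cong_dvd_modulus) simp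
    also have "[1 = x n * f n] (mod int p ^ n)"
      using f[of n] by (rule cong_sym)
    finally show ?thesis
      using cong_mult_lcancel[OF cop] by (simp add: cong_def)
  qed
  then have "(\<lambda>n. f n mod int p ^ n) \<in> padic_ints p"
    by (rule padic_intsI[OF p])
  moreover have "padic_mult p x (\<lambda>n. f n mod int p ^ n) = padic_of_int p 1"
    using f by (simp add: padic_mult_def padic_of_int_def mod_simps cong_def)
  ultimately show ?thesis by blast
qed

lemma padic_inverse_mult:
  assumes p: "prime p" and x: "x \<in> padic_ints p" and x1: "x 1 \<noteq> 0" and y: "y \<in> padic_ints p"
  shows "\<exists>z\<in>padic_ints p. padic_mult p x z = y"
proof -
  obtain u where u: "u \<in> padic_ints p" "padic_mult p x u = padic_of_int p 1"
    using padic_inverse[OF p x x1] by blast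
  have "padic_mult p x (padic_mult p u y) = padic_mult p (padic_mult p x u) y"
    by (simp add: padic_mult_def mod_simps mult.assoc)
  also have "\<dots> = y"
    using padic_intsD(4)[OF y] unfolding u(2) by (simp add: padic_mult_def padic_of_int_def mod_simps)
  finally show ?thesis
    using padic_mult_closed[OF p u(1) y] by blast
qed

lemma padic_divide_prime:
  assumes p: "prime p" and x: "x \<in> padic_ints p" and x1: "x 1 = 0"
  shows "\<exists>z\<in>padic_ints p. padic_mult p (padic_of_int p (int p)) z = x"
proof -
  \<comment> \<open>Dividing by \<open>p\<close> costs one digit, so level \<open>n\<close> of the
    quotient is read off from level \<open>Suc n\<close> of \<open>x\<close>.\<close>
  define f where "f n = x (Suc n) div int p" for n
  have pos: "int p > 0" using p prime_gt_0_nat by simp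
  have xf: "x (Suc n) = int p * f n" for n
  proof -
    have "x (Suc n) mod int p = 0"
      using padic_residue[OF x, of 1 "Suc n"] x1 by simp
    then show ?thesis by (simp add: f_def mod_0_imp_dvd)
  qed
  have "f (Suc n) mod int p ^ n = f n mod int p ^ n" for n
  proof -
    \<comment> \<open>After multiplication by \<open>p\<close> the claim becomes the compatibility
      of \<open>x\<close> one level higher.\<close>
    have "int p * (f (Suc n) mod int p ^ n) = int p * f (Suc n) mod int p ^ Suc n"
      by (simp only: mult_mod_right power_Suc)
    also have "\<dots> = int p * f n mod int p ^ Suc n"
      using padic_intsD(3,4)[OF x, of "Suc n"] by (simp only: flip: xf)
    also have "\<dots> = int p * (f n mod int p ^ n)"
      by (simp only: mult_mod_right power_Suc)
    finally show ?thesis using pos by simp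
  qed
  then have "(\<lambda>n. f n mod int p ^ n) \<in> padic_ints p"
    by (rule padic_intsI[OF p])
  moreover have "padic_mult p (padic_of_int p (int p)) (\<lambda>n. f n mod int p ^ n) = x"
  proof
    fix n
    show "padic_mult p (padic_of_int p (int p)) (\<lambda>n. f n mod int p ^ n) n = x n"
      using padic_intsD(3)[OF x, of n]
      by (simp add: padic_mult_def padic_of_int_def mod_simps flip: xf)
  qed
  ultimately show ?thesis by blast
qed

section \<open>Divisibility in the ring of profinite integers\<close>

lemma zhat_comp_mult: "prime p \<Longrightarrow> zhat_comp (x * y) p = padic_mult p (zhat_comp x p) (zhat_comp y p)"
  by (simp add: times_zhat.rep_eq)

lemma zhat_comp_of_nat: "prime p \<Longrightarrow> zhat_comp (of_nat n) p = padic_of_int p (int n)"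
  by (induction n)
    (simp_all add: zero_zhat.rep_eq one_zhat.rep_eq plus_zhat.rep_eq padic_add_def
      padic_of_int_def mod_simps)

lemma zhat_comp_minus_of_nat:
  "prime p \<Longrightarrow> zhat_comp (x - of_nat n) p i = (zhat_comp x p i - int n) mod int p ^ i"
  unfolding minus_zhat_def
  by (simp add: plus_zhat.rep_eq uminus_zhat.rep_eq zhat_comp_of_nat
      padic_add_def padic_uminus_def padic_of_int_def mod_simps
      del: add_uminus_conv_diff) (simp add: mod_simps)

text \<open>The ring is a full product over the primes, so independent choices of components always
  form an element.\<close>

lemma zhat_choice:
  assumes "\<And>p. prime p \<Longrightarrow> \<exists>y\<in>padic_ints p. P p y"
  shows "\<exists>z. \<forall>p. prime p \<longrightarrow> P p (zhat_comp z p)"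
proof -
  from assms obtain v where v: "\<And>p. prime p \<Longrightarrow> v p \<in> padic_ints p" "\<And>p. prime p \<Longrightarrow> P p (v p)"
    by metis
  have "zhat_comp (Abs_zhat (\<lambda>p\<in>{p. prime p}. v p)) = (\<lambda>p\<in>{p. prime p}. v p)"
    by (rule Abs_zhat_inverse) (simp add: v)
  then show ?thesis
    using v(2) by (intro exI[of _ "Abs_zhat (\<lambda>p\<in>{p. prime p}. v p)"]) simp
qed

lemma zhat_dvdI:
  assumes "\<And>p. prime p \<Longrightarrow> \<exists>z\<in>padic_ints p. padic_mult p (zhat_comp x p) z = zhat_comp y p"
  shows "x dvd y"
proof -
  obtain z where "\<And>p. prime p \<Longrightarrow> padic_mult p (zhat_comp x p) (zhat_comp z p) = zhat_comp y p"
    using zhat_choice[OF assms] by blast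
  then have "y = x * z"
    by (intro zhat_eqI) (simp add: zhat_comp_mult)
  then show ?thesis ..
qed

text \<open>Only the component at \<open>q\<close> is an obstacle: at every other prime,
  \<open>q\<close> is a p-adic unit.\<close>

lemma prime_dvd_zhat_iff:
  assumes q: "prime q"
  shows "of_nat q dvd x \<longleftrightarrow> zhat_comp x q 1 = 0"
proof
  assume "of_nat q dvd x"
  then obtain z where "x = of_nat q * z" ..
  then show "zhat_comp x q 1 = 0"
    using q by (simp add: zhat_comp_mult zhat_comp_of_nat padic_mult_def padic_of_int_def mod_simps)
next
  assume x1: "zhat_comp x q 1 = 0"
  show "of_nat q dvd x"
  proof (rule zhat_dvdI)
    fix p :: nat assume p: "prime p"
    note xp = zhat_comp_closed[OF p, of x]
    show "\<exists>z\<in>padic_ints p. padic_mult p (zhat_comp (of_nat q) p) z = zhat_comp x p"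
    proof (cases "p = q")
      case True
      then show ?thesis
        using padic_divide_prime[OF p xp] x1 by (simp add: zhat_comp_of_nat q)
    next
      case False
      then have "\<not> p dvd q"
        using p q primes_dvd_imp_eq by blast
      then have "zhat_comp (of_nat q) p 1 \<noteq> 0"
        using p by (simp add: zhat_comp_of_nat padic_of_int_def mod_eq_0_iff_dvd)
      then show ?thesis
        using padic_inverse_mult[OF p zhat_comp_closed[OF p] _ xp] by blast
    qed
  qed
qed

text \<open>Multiplication by \<open>q\<close> shifts the digits at \<open>q\<close> by one place.
  This drives the induction on prime powers and the cancellation of \<open>q\<close>.\<close>

lemma zhat_comp_prime_mult_eq_0:
  assumes q: "prime q"
  shows "zhat_comp (of_nat q * z) q (Suc n) = 0 \<longleftrightarrow> zhat_comp z q n = 0"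
proof -
  have pos: "int q > 0" using q prime_gt_0_nat by simp
  have "zhat_comp (of_nat q * z) q (Suc n) = int q * zhat_comp z q (Suc n) mod int q ^ Suc n"
    using q by (simp add: zhat_comp_mult zhat_comp_of_nat padic_mult_def padic_of_int_def mod_simps)
  also have "\<dots> = int q * (zhat_comp z q (Suc n) mod int q ^ n)"
    by (simp only: mult_mod_right power_Suc)
  also have "\<dots> = int q * zhat_comp z q n"
    using padic_intsD(3)[OF zhat_comp_closed[OF q]] by simp
  finally show ?thesis using pos by simp
qed

lemma prime_power_dvd_zhat_iff:
  assumes q: "prime q"
  shows "of_nat (q ^ n) dvd x \<longleftrightarrow> zhat_comp x q n = 0"
proof (induction n arbitrary: x)
  case 0
  then show ?case using padic_zero[OF zhat_comp_closed[OF q]] by simp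
next
  case (Suc n)
  show ?case
  proof
    assume "of_nat (q ^ Suc n) dvd x"
    then obtain z where "x = of_nat q * (of_nat (q ^ n) * z)"
      by (auto simp: mult.assoc elim: dvdE)
    then show "zhat_comp x q (Suc n) = 0"
      using Suc.IH[of "of_nat (q ^ n) * z"] zhat_comp_prime_mult_eq_0[OF q] by simp
  next
    assume *: "zhat_comp x q (Suc n) = 0"
    then have "zhat_comp x q 1 = 0"
      using padic_eq_zero_mono[OF zhat_comp_closed[OF q]] by simp
    then obtain z where z: "x = of_nat q * z"
      using prime_dvd_zhat_iff[OF q] by blast
    then show "of_nat (q ^ Suc n) dvd x"
      using * Suc.IH zhat_comp_prime_mult_eq_0[OF q] by (simp add: mult_dvd_mono)
  qed
qed

text \<open>At \<open>q\<close> this is the digit shift; at another prime \<open>p\<close> it holds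
  because \<open>q\<close> is coprime to every \<open>p ^ n\<close>.\<close>

lemma zhat_prime_mult_eq_0:
  assumes q: "prime q" and z: "of_nat q * z = (0::zhat)"
  shows "z = 0"
proof (rule zhat_eqI)
  fix p :: nat assume p: "prime p"
  have "zhat_comp z p n = 0" for n
  proof (cases "p = q")
    case True
    have "zhat_comp (of_nat q * z) q (Suc n) = 0"
      using q by (simp add: z zero_zhat.rep_eq padic_of_int_def)
    then show ?thesis
      using True zhat_comp_prime_mult_eq_0[OF q] by simp
  next
    case False
    have "zhat_comp (of_nat q * z) p n = 0"
      using p by (simp add: z zero_zhat.rep_eq padic_of_int_def)
    then have "int p ^ n dvd int q * zhat_comp z p n"
      using p by (simp add: zhat_comp_mult zhat_comp_of_nat padic_mult_def padic_of_int_def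
          mod_simps mod_eq_0_iff_dvd)
    moreover have "coprime (int p ^ n) (int q)"
      using primes_coprime[OF p q False] by simp
    ultimately have "int p ^ n dvd zhat_comp z p n"
      using coprime_dvd_mult_right_iff by blast
    then show ?thesis
      using padic_intsD(4)[OF zhat_comp_closed[OF p], of z n] by simp
  qed
  then show "zhat_comp z p = zhat_comp 0 p"
    using p by (auto simp: zero_zhat.rep_eq padic_of_int_def)
qed

lemma zhat_of_nat_mult_eq_0:
  fixes k :: nat
  assumes "k \<noteq> 0" "of_nat k * z = (0::zhat)"
  shows "z = 0"
  using assms
proof (induction k arbitrary: z rule: prime_divisors_induct)
  case (factor p k)
  have "of_nat p * (of_nat k * z) = 0"
    using factor.prems(2) by (simp only: of_nat_mult mult.assoc)
  then have "of_nat k * z = 0"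
    by (rule zhat_prime_mult_eq_0[OF factor.hyps])
  moreover have "k \<noteq> 0"
    using factor.prems(1) by simp
  ultimately show ?case
    using factor.IH by blast
qed auto

lemma zhat_of_nat_mult_cancel:
  assumes "k \<noteq> 0" "of_nat k * x = of_nat k * (y::zhat)"
  shows "x = y"
  using zhat_of_nat_mult_eq_0[of k "x - y"] assms by (simp add: right_diff_distrib)

lemma zhat_of_nat_mult_dvd_cancel:
  assumes "k \<noteq> 0" "of_nat k * x dvd of_nat k * (y::zhat)"
  shows "x dvd y"
proof -
  obtain z where "of_nat k * y = of_nat k * (x * z)"
    using assms(2) by (auto simp: mult.assoc elim: dvdE)
  then have "y = x * z"
    by (rule zhat_of_nat_mult_cancel[OF assms(1)])
  then show ?thesis ..
qed

text \<open>For the hard direction, primes are peeled off \<open>k\<close> one at a time: the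
  residue of \<open>c\<close> at \<open>p\<close> vanishes, so \<open>p\<close> divides
  \<open>c\<close>, and then \<open>p\<close> is cancelled on both sides.\<close>

lemma of_nat_dvd_zhat_of_nat_iff: "of_nat k dvd (of_nat c :: zhat) \<longleftrightarrow> k dvd c" if "k \<noteq> 0"
proof
  show "of_nat k dvd (of_nat c :: zhat)" if "k dvd c"
    using that by (auto elim: dvdE)
  assume "of_nat k dvd (of_nat c :: zhat)"
  with that show "k dvd c"
  proof (induction k arbitrary: c rule: prime_divisors_induct)
    case (factor p k)
    have "of_nat p dvd (of_nat c :: zhat)"
      using factor.prems(2) by (metis dvd_mult_left of_nat_mult)
    then have "int c mod int p = 0"
      using factor.hyps
      by (simp add: prime_dvd_zhat_iff zhat_comp_of_nat padic_of_int_def)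
    then obtain d where d: "c = p * d"
      by (metis dvdE mod_eq_0_iff_dvd of_nat_dvd_iff)
    have "of_nat p * of_nat k dvd (of_nat p * of_nat d :: zhat)"
      using factor.prems(2) by (simp only: d of_nat_mult)
    then have "of_nat k dvd (of_nat d :: zhat)"
      using factor.prems(1) by (intro zhat_of_nat_mult_dvd_cancel[of p "of_nat k"]) simp_all
    then show ?case
      using factor.IH[of d] factor.prems by (simp add: d)
  qed simp_all
qed

text \<open>A mixed-radix expansion along the prime factors of \<open>k\<close>: if \<open>c\<close>
  is the residue of \<open>r\<close> modulo \<open>p\<close> and \<open>n\<close> approximates
  \<open>(r - c) / p\<close> modulo \<open>k\<close>, then \<open>c + p * n\<close> approximates
  \<open>r\<close> modulo \<open>p * k\<close>.\<close>

lemma zhat_approx_nat: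
  assumes "k \<noteq> 0"
  shows "\<exists>n. of_nat k dvd r - (of_nat n :: zhat)"
  using assms
proof (induction k arbitrary: r rule: prime_divisors_induct)
  case (factor p k)
  let ?c = "nat (zhat_comp r p 1)"
  have "int ?c = zhat_comp r p 1"
    using padic_intsD(1)[OF zhat_comp_closed[OF factor.hyps]] by simp
  then have "of_nat p dvd r - of_nat ?c"
    using factor.hyps by (simp add: prime_dvd_zhat_iff zhat_comp_minus_of_nat)
  then obtain z where z: "r - of_nat ?c = of_nat p * z" ..
  obtain n where "of_nat k dvd z - (of_nat n :: zhat)"
    using factor by auto
  then obtain w where "z - of_nat n = of_nat k * w" ..
  then have "of_nat (p * k) * w = of_nat p * (z - of_nat n)"
    by (simp add: mult.assoc)
  also have "\<dots> = r - of_nat (?c + p * n)"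
    using z by (simp add: algebra_simps)
  finally show ?case
    by (metis dvd_triv_left)
next
  case (unit k)
  then have "k = 1" by simp
  then show ?case by simp
qed simp

text \<open>The lower bound will turn congruences between naturals into relations
  \<open>n = m + k * i\<close> with \<open>i\<close> natural, as the order requires.\<close>

lemma zhat_approx_nat_ge:
  assumes "k \<noteq> 0"
  shows "\<exists>n\<ge>b. of_nat k dvd r - (of_nat n :: zhat)"
proof -
  obtain n where n: "of_nat k dvd r - (of_nat n :: zhat)"
    using zhat_approx_nat[OF assms, of r] ..
  have "of_nat k dvd (r - of_nat n) - (of_nat k * of_nat b :: zhat)"
    using n by (rule dvd_diff) simp
  then have "of_nat k dvd r - (of_nat (n + k * b) :: zhat)"
    by (simp add: algebra_simps)
  moreover have "b \<le> n + k * b"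
    using assms by (simp add: trans_le_add2)
  ultimately show ?thesis by blast
qed

text \<open>Bezout coefficients with \<open>u * k + v * l = 1\<close> write \<open>x\<close> as a
  sum of two multiples of \<open>k\<close>.\<close>

lemma zhat_coprime_dvd_mult:
  assumes "coprime k l" "of_nat k dvd of_nat l * (x::zhat)"
  shows "of_nat k dvd x"
proof -
  obtain u v where "u * int k + v * int l = 1"
    using bezout_int[of "int k" "int l"] assms(1) by auto
  then have "of_int (u * int k + v * int l) * x = 1 * x"
    by simp
  then have "x = of_nat k * (of_int u * x) + of_int v * (of_nat l * x)"
    by (simp add: algebra_simps)
  moreover have "of_nat k dvd of_nat k * (of_int u * x) + of_int v * (of_nat l * x)"
    by (rule dvd_add[OF dvd_triv_left dvd_mult[OF assms(2)]])
  ultimately show ?thesis by simp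
qed

text \<open>Cancelling the gcd, which is allowed in a torsion-free ring, leaves the coprime
  case.\<close>

lemma zhat_dvd_mult_gcd:
  assumes "l \<noteq> 0" "of_nat l dvd of_nat k * (x::zhat)"
  shows "of_nat (l div gcd l k) dvd x"
proof -
  let ?g = "gcd l k"
  have "of_nat (?g * (l div ?g)) dvd of_nat (?g * (k div ?g)) * x"
    using assms by simp
  then have "of_nat ?g * of_nat (l div ?g) dvd of_nat ?g * (of_nat (k div ?g) * x)"
    by (simp only: of_nat_mult mult.assoc)
  then have "of_nat (l div ?g) dvd of_nat (k div ?g) * x"
    by (rule zhat_of_nat_mult_dvd_cancel[rotated]) (use assms(1) in simp)
  moreover have "coprime (l div ?g) (k div ?g)"
    using assms(1) by (intro div_gcd_coprime) simp
  ultimately show ?thesis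
    by (rule zhat_coprime_dvd_mult[rotated])
qed

text \<open>With \<open>x = k * y\<close>, the previous lemma gives \<open>l div gcd l k\<close> as
  a divisor of \<open>y\<close>, and \<open>k\<close> times it is the lcm.\<close>

lemma zhat_lcm_dvd:
  assumes "k \<noteq> 0" "of_nat k dvd (x::zhat)" "of_nat l dvd x" "l \<noteq> 0"
  shows "of_nat (lcm k l) dvd x"
proof -
  obtain y where y: "x = of_nat k * y"
    using assms(2) ..
  then have "of_nat (l div gcd l k) dvd y"
    using assms by (intro zhat_dvd_mult_gcd[of l k y]) simp_all
  then have "of_nat k * of_nat (l div gcd l k) dvd x"
    unfolding y by (rule mult_dvd_mono[OF dvd_refl])
  moreover have "lcm k l = k * (l div gcd l k)"
    by (simp add: lcm_nat_def div_mult_swap gcd.commute)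
  ultimately show ?thesis by simp
qed

text \<open>At each prime \<open>p\<close> the powers of \<open>p\<close> dividing \<open>a\<close>
  suffice. Either all of them do and both components vanish, or an exact power \<open>p ^ v\<close>
  can be split off from \<open>a\<close> and \<open>y\<close>, leaving a unit at \<open>p\<close> as
  the cofactor of \<open>a\<close>.\<close>

lemma zhat_dvd_if_nat_divisors:
  assumes *: "\<And>k. k \<noteq> 0 \<Longrightarrow> of_nat k dvd a \<Longrightarrow> of_nat k dvd (y::zhat)"
  shows "a dvd y"
proof (rule zhat_dvdI)
  fix p :: nat assume p: "prime p"
  note cl = zhat_comp_closed[OF p]
  have imp: "of_nat (p ^ n) dvd y" if "zhat_comp a p n = 0" for n
    using that *[of "p ^ n"] p prime_power_dvd_zhat_iff[OF p] by auto
  show "\<exists>z\<in>padic_ints p. padic_mult p (zhat_comp a p) z = zhat_comp y p"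
  proof (cases "\<forall>n. zhat_comp a p n = 0")
    case True
    then have "zhat_comp y p n = 0" for n
      using imp prime_power_dvd_zhat_iff[OF p] by blast
    \<comment> \<open>Both components are zero, so any p-adic integer serves as the
      quotient.\<close>
    then have "padic_mult p (zhat_comp a p) (zhat_comp a p) = zhat_comp y p"
      using True by (auto simp: padic_mult_def)
    then show ?thesis using cl by blast
  next
    case False
    \<comment> \<open>The shift by \<open>Suc\<close> makes \<open>v\<close> the p-adic valuation of
      \<open>a\<close>: residue \<open>v\<close> is still zero and residue \<open>Suc v\<close> is
      not.\<close>
    define v where "v = (LEAST n. zhat_comp a p (Suc n) \<noteq> 0)"
    obtain n where "zhat_comp a p (Suc n) \<noteq> 0"
      using False padic_zero[OF cl] by (metis not0_implies_Suc)
    then have v1: "zhat_comp a p (Suc v) \<noteq> 0"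
      unfolding v_def by (rule LeastI)
    have v0: "zhat_comp a p v = 0"
    proof (cases v)
      case (Suc w)
      then show ?thesis
        using not_less_Least[of w "\<lambda>n. zhat_comp a p (Suc n) \<noteq> 0"] unfolding v_def by simp
    qed (simp add: padic_zero[OF cl])
    then obtain b where b: "a = of_nat (p ^ v) * b"
      using prime_power_dvd_zhat_iff[OF p] by blast
    obtain x where x: "y = of_nat (p ^ v) * x"
      using imp[OF v0] ..
    have "zhat_comp b p 1 \<noteq> 0"
    proof
      assume "zhat_comp b p 1 = 0"
      then have "of_nat (p ^ v) * of_nat p dvd a"
        unfolding b using prime_dvd_zhat_iff[OF p] by (intro mult_dvd_mono) simp_all
      then show False
        using v1 prime_power_dvd_zhat_iff[OF p, of "Suc v" a] by (simp add: mult.commute)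
    qed
    then obtain z where z: "z \<in> padic_ints p" "padic_mult p (zhat_comp b p) z = zhat_comp x p"
      using padic_inverse_mult[OF p cl _ cl] by blast
    have "padic_mult p (zhat_comp a p) z
        = padic_mult p (zhat_comp (of_nat (p ^ v)) p) (padic_mult p (zhat_comp b p) z)"
      unfolding b using p by (simp add: zhat_comp_mult padic_mult_def mod_simps mult.assoc)
    also have "\<dots> = zhat_comp y p"
      unfolding z(2) x using p by (simp add: zhat_comp_mult)
    finally show ?thesis using z(1) by blast
  qed
qed

text \<open>Zero divisors may keep the cofactor \<open>t\<close> from being a unit. A unit is
  therefore assembled prime by prime: the component of \<open>t\<close> where it is invertible, and
  1 elsewhere.\<close>

lemma zhat_associated:
  assumes "a dvd b" "b dvd (a::zhat)"
  shows "orbit_of a = orbit_of b"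
proof -
  obtain s t where t: "b = a * t" and s: "a = b * s"
    using assms by (auto elim!: dvdE)
  have "\<exists>y\<in>padic_ints p. y \<in> padic_units p \<and> padic_mult p y (zhat_comp a p) = zhat_comp b p"
    if p: "prime p" for p
  proof -
    note cl = zhat_comp_closed[OF p]
    show ?thesis
    proof (cases "zhat_comp t p 1 = 0")
      case False
      then have "zhat_comp t p \<in> padic_units p"
        using padic_inverse[OF p cl] cl by (auto simp: padic_units_def)
      moreover have "padic_mult p (zhat_comp t p) (zhat_comp a p) = zhat_comp b p"
        using p by (simp add: t zhat_comp_mult[symmetric] mult.commute)
      ultimately show ?thesis using cl by blast
    next
      case True
      \<comment> \<open>Since \<open>p\<close> divides \<open>t\<close> and \<open>a = a t s\<close>, both \<open>a\<close> and \<open>b\<close> vanish at \<open>p\<close>.\<close>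
      have ann: "a = a * (t * s)"
        using s t by (simp add: mult.assoc)
      \<comment> \<open>Each use of \<open>a = a * (t * s)\<close> gains one more factor
        \<open>p\<close> from \<open>t\<close>.\<close>
      have "of_nat (p ^ n) dvd a" for n
      proof (induction n)
        case (Suc n)
        have "of_nat p dvd t"
          using True prime_dvd_zhat_iff[OF p] by blast
        then have "of_nat (p ^ n) * of_nat p dvd a * (t * s)"
          using Suc by (intro mult_dvd_mono dvd_mult2)
        then show ?case using ann by (simp add: mult.commute)
      qed simp
      then have "of_nat (p ^ n) dvd a" "of_nat (p ^ n) dvd b" for n
        using t by (auto intro: dvd_mult2)
      then have "zhat_comp a p n = 0" "zhat_comp b p n = 0" for n
        using prime_power_dvd_zhat_iff[OF p] by blast+
      then have "padic_mult p (zhat_comp 1 p) (zhat_comp a p) = zhat_comp b p"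
        by (auto simp: padic_mult_def)
      moreover have "zhat_comp 1 p \<in> padic_units p"
        using zhat_units_iff[of 1] p by (simp add: zhat_units_def)
      ultimately show ?thesis using cl by blast
    qed
  qed
  then have "\<exists>u. \<forall>p. prime p \<longrightarrow> zhat_comp u p \<in> padic_units p
      \<and> padic_mult p (zhat_comp u p) (zhat_comp a p) = zhat_comp b p"
    by (rule zhat_choice)
  then obtain u where "\<And>p. prime p \<Longrightarrow> zhat_comp u p \<in> padic_units p"
      "\<And>p. prime p \<Longrightarrow> padic_mult p (zhat_comp u p) (zhat_comp a p) = zhat_comp b p"
    by blast
  then have "u \<in> zhat_units" "b = u * a"
    by (auto simp: zhat_units_def zhat_comp_mult intro!: zhat_eqI)
  then show ?thesis
    by (auto simp: zhat_orbit.abs_eq_iff zhat_orbit_rel_def)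
qed

section \<open>Ideals, unit orbits, and the order on pairs\<close>

lemma zhat_ideal_iff: "x \<in> zhat_ideal a \<longleftrightarrow> a dvd x"
  by (auto simp: zhat_ideal_def dvd_def)

lemma orbit_of_in_image_ideal_iff: "orbit_of b \<in> orbit_of ` zhat_ideal c \<longleftrightarrow> c dvd b"
proof
  assume "orbit_of b \<in> orbit_of ` zhat_ideal c"
  then obtain u where "c dvd u * b" "u dvd 1"
    by (auto simp: zhat_orbit.abs_eq_iff zhat_orbit_rel_def zhat_ideal_iff zhat_units_iff)
  moreover obtain v where "1 = u * v"
    using \<open>u dvd 1\<close> ..
  then have "b = v * (u * b)"
    by (metis mult.assoc mult.commute mult_1)
  ultimately show "c dvd b"
    by (metis dvd_mult)
qed (auto simp: zhat_ideal_iff)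

lemma group_QQ: "group QQ"
proof (rule groupI)
  fix x assume "x \<in> carrier QQ"
  then show "\<exists>y\<in>carrier QQ. y \<otimes>\<^bsub>QQ\<^esub> x = \<one>\<^bsub>QQ\<^esub>"
    by (intro bexI[of _ "(- (fst x / snd x), 1 / snd x)"]) (auto simp: semidirect_def)
qed (auto simp: semidirect_def algebra_simps)

text \<open>In the rational group, the inverse of \<open>(m, k)\<close> times \<open>(n, l)\<close>
  is \<open>((n - m) / k, l / k)\<close>, and both coordinates must be natural.\<close>

lemma NN_le_iff:
  assumes "k \<noteq> 0" "l \<noteq> 0"
  shows "NN_le (m, k) (n, l) \<longleftrightarrow> (\<exists>i j. n = m + k * i \<and> l = k * j)"
proof -
  let ?m = "of_nat m :: rat" and ?k = "of_nat k :: rat"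
  have "inv\<^bsub>QQ\<^esub> (?m, ?k) = (- (?m / ?k), 1 / ?k)"
    by (rule group.inv_equality[OF group_QQ]) (use assms in \<open>auto simp: semidirect_def\<close>)
  then have "inv\<^bsub>QQ\<^esub> (NN_to_QQ (m, k)) \<otimes>\<^bsub>QQ\<^esub> NN_to_QQ (n, l)
      = (- (?m / ?k) + 1 / ?k * of_nat n, 1 / ?k * of_nat l)"
    by (simp add: NN_to_QQ_def semidirect_def)
  then have "NN_le (m, k) (n, l) \<longleftrightarrow> (\<exists>i j. j \<noteq> 0 \<and>
      - (?m / ?k) + 1 / ?k * of_nat n = of_nat i \<and> 1 / ?k * of_nat l = of_nat j)"
    unfolding NN_le_def by (auto simp: NN_to_QQ_def semidirect_def image_iff)
  also have "\<dots> \<longleftrightarrow> (\<exists>i j. j \<noteq> 0 \<and>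
      (of_nat n :: rat) = of_nat (m + k * i) \<and> (of_nat l :: rat) = of_nat (k * j))"
    using assms by (simp add: field_simps)
  also have "\<dots> \<longleftrightarrow> (\<exists>i j. n = m + k * i \<and> l = k * j)"
    using assms unfolding of_nat_eq_iff by (metis mult_0_right)
  finally show ?thesis .
qed

section \<open>The map \<open>ptilde\<close> on representatives: its values and its
  injectivity\<close>

fun near :: "nat + zhat \<Rightarrow> nat \<Rightarrow> nat \<Rightarrow> bool" where
  "near (Inl r) k m \<longleftrightarrow> (\<exists>j. r = m + k * j)"
| "near (Inr s) k m \<longleftrightarrow> of_nat k dvd s - of_nat m"

text \<open>When \<open>k\<close> divides \<open>b\<close>, a coset modulo \<open>b\<close> lies in
  a single class modulo \<open>k\<close>. Testing the representative \<open>t\<close> by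
  \<open>near\<close> is therefore enough, and naturals and profinite integers can be treated
  alike.\<close>

lemma ptilde_Nbar_proj:
  "ptilde (Nbar_proj (t, orbit_of b)) = {(m, k). k \<noteq> 0 \<and> of_nat k dvd b \<and> near t k m}"
proof (cases t)
  case (Inl r)
  have "(\<exists>j. int r - int m = int k * int j) \<longleftrightarrow> (\<exists>j. r = m + k * j)" for m k
    by (simp add: diff_eq_eq add.commute flip: of_nat_mult of_nat_add)
  then show ?thesis
    by (auto simp: Inl Nbar_proj_def semidirect_def orbit_of_in_image_ideal_iff)
next
  case (Inr s)
  have "(\<lambda>s. s - of_nat m) ` (+) s ` zhat_ideal b \<subseteq> zhat_ideal (of_nat k)
      \<longleftrightarrow> of_nat k dvd s - of_nat m" if "of_nat k dvd b" for m k
  proof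
    assume "(\<lambda>s. s - of_nat m) ` (+) s ` zhat_ideal b \<subseteq> zhat_ideal (of_nat k)"
    then show "of_nat k dvd s - of_nat m"
      using zero_in_zhat_ideal[of b] by (auto simp: zhat_ideal_iff image_subset_iff dest: bspec)
  next
    assume *: "of_nat k dvd s - of_nat m"
    have "of_nat k dvd (s - of_nat m) + z" if "b dvd z" for z
      using * dvd_trans[OF \<open>of_nat k dvd b\<close> that] by (rule dvd_add)
    then show "(\<lambda>s. s - of_nat m) ` (+) s ` zhat_ideal b \<subseteq> zhat_ideal (of_nat k)"
      by (auto simp: zhat_ideal_iff algebra_simps)
  qed
  then show ?thesis
    by (simp add: Inr Nbar_proj_def semidirect_def orbit_of_in_image_ideal_iff orbit_ideal.abs_eq
        cong: conj_cong)
qed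

lemma Nbar_proj_in_Nbar_space: "Nbar_proj x \<in> Nbar_space"
  using range_Nbar_proj by blast

lemma Nbar_space_cases:
  assumes "z \<in> Nbar_space"
  obtains t b where "z = Nbar_proj (t, orbit_of b)"
proof -
  obtain t a where "z = Nbar_proj (t, a)"
    using assms by (metis imageE range_Nbar_proj surj_pair)
  then show ?thesis
    using that orbit_ideal_obtain[of a] by metis
qed

lemma near_mono:
  assumes "near t (k * j) (m + k * i)"
  shows "near t k m"
proof (cases t)
  case (Inl r)
  then obtain h where "r = m + k * (i + j * h)"
    using assms by (auto simp: algebra_simps)
  then show ?thesis
    using Inl by auto
next
  case (Inr s)
  then have "of_nat k dvd s - of_nat (m + k * i)"
    using assms by (auto intro: dvd_mult_left)
  then have "of_nat k dvd s - of_nat (m + k * i) + of_nat k * of_nat i"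
    by (rule dvd_add) simp
  then show ?thesis
    using Inr by (simp add: algebra_simps)
qed

text \<open>For natural \<open>t = r\<close> take \<open>n = r\<close>; for profinite
  \<open>t\<close> take an approximation modulo \<open>l\<close> that is at least \<open>B\<close>,
  so that each \<open>n - m\<close> is a natural multiple of \<open>k\<close>.\<close>

lemma near_upper_bound:
  assumes "l \<noteq> 0"
  shows "\<exists>n. near t l n \<and> (\<forall>m\<le>B. \<forall>k. k dvd l \<longrightarrow> near t k m \<longrightarrow> (\<exists>i. n = m + k * i))"
proof (cases t)
  case (Inl r)
  then show ?thesis by (intro exI[of _ r]) auto
next
  case (Inr s)
  obtain n where n: "n \<ge> B" "of_nat l dvd s - of_nat n"
    using zhat_approx_nat_ge[OF assms] by blast
  have "\<exists>i. n = m + k * i" if m: "m \<le> B" and k: "k dvd l" "of_nat k dvd s - of_nat m" for m k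
  proof -
    have "of_nat k dvd s - of_nat n"
      using k(1) n(2) by (metis dvd_trans of_nat_dvd_iff of_nat_dvd_zhat_of_nat_iff dvd_0_left assms)
    then have "of_nat k dvd (s - of_nat m) - (s - of_nat n)"
      by (rule dvd_diff[OF k(2)])
    moreover have "(s - of_nat m) - (s - of_nat n) = of_nat (n - m)"
      using m n(1) by (simp add: of_nat_diff)
    moreover have "k \<noteq> 0"
      using k(1) assms by auto
    ultimately have "k dvd n - m"
      using of_nat_dvd_zhat_of_nat_iff[of k "n - m"] by simp
    then obtain i where "n - m = k * i" ..
    then have "n = m + k * i"
      using m n(1) by simp
    then show ?thesis ..
  qed
  then show ?thesis
    using Inr n(2) by auto
qed

lemma near_exists: "l \<noteq> 0 \<Longrightarrow> \<exists>n. near t l n"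
  using near_upper_bound by blast

text \<open>For directedness, the lcm of two moduli again divides \<open>b\<close>, and
  \<open>near_upper_bound\<close> at that lcm supplies the first coordinate of a common upper
  bound.\<close>

lemma ptilde_in_nica_spectrum:
  assumes "z \<in> Nbar_space"
  shows "ptilde z \<in> nica_spectrum"
proof -
  obtain t b where z: "z = Nbar_proj (t, orbit_of b)"
    using assms by (rule Nbar_space_cases)
  note p = ptilde_Nbar_proj[of t b, folded z]
  have "ptilde z \<subseteq> carrier NN"
    by (auto simp: p semidirect_def)
  moreover have "ptilde z \<noteq> {}"
  proof -
    obtain n where "near t 1 n"
      using near_exists[OF one_neq_zero] ..
    then have "(n, 1) \<in> ptilde z"
      by (simp add: p)
    then show ?thesis by blast
  qed
  moreover have "hereditary (ptilde z)"
    unfolding hereditary_def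
  proof (intro ballI impI)
    fix y x assume y: "y \<in> ptilde z" and x: "x \<in> carrier NN" and le: "NN_le x y"
    obtain m k n l where xy: "x = (m, k)" "y = (n, l)"
      using surj_pair by metis
    have "k \<noteq> 0" "l \<noteq> 0"
      using x y by (auto simp: xy p semidirect_def)
    then obtain i j where "n = m + k * i" "l = k * j"
      using le by (auto simp: xy NN_le_iff)
    then show "x \<in> ptilde z"
      using y \<open>k \<noteq> 0\<close> by (auto simp: xy p intro: near_mono dvd_mult_left)
  qed
  moreover have "directed (ptilde z)"
    unfolding directed_def
  proof (intro ballI)
    fix x y assume x: "x \<in> ptilde z" and y: "y \<in> ptilde z"
    obtain m k n l where xy: "x = (m, k)" "y = (n, l)"
      using surj_pair by metis
    have kl: "k \<noteq> 0" "l \<noteq> 0" "lcm k l \<noteq> 0"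
      using x y by (auto simp: xy p)
    obtain h where h: "near t (lcm k l) h"
      "\<forall>m'\<le>max m n. \<forall>k'. k' dvd lcm k l \<longrightarrow> near t k' m' \<longrightarrow> (\<exists>i. h = m' + k' * i)"
      using near_upper_bound[OF kl(3)] by blast
    have "\<exists>i. h = m + k * i" "\<exists>i. h = n + l * i"
      using h(2) x y by (auto simp: xy p)
    moreover have "\<exists>j. lcm k l = k * j" "\<exists>j. lcm k l = l * j"
      using dvd_lcm1 dvd_lcm2 by (blast elim: dvdE)+
    ultimately have "NN_le x (h, lcm k l)" "NN_le y (h, lcm k l)"
      unfolding xy NN_le_iff[OF kl(1,3)] NN_le_iff[OF kl(2,3)] by blast+
    moreover have "(h, lcm k l) \<in> ptilde z"
      using h(1) kl x y by (simp add: xy p zhat_lcm_dvd lcm_pos_nat)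
    ultimately show "\<exists>h\<in>ptilde z. NN_le x h \<and> NN_le y h"
      by blast
  qed
  ultimately show ?thesis
    by (simp add: nica_spectrum_def)
qed

text \<open>The moduli that occur in the set are the natural divisors of \<open>b\<close>, so they
  fix its orbit. The first coordinates then fix \<open>t\<close>: at modulus 1 a natural point is
  their maximum, and a profinite point is determined modulo every such \<open>k\<close>, hence
  modulo \<open>b\<close>.\<close>

lemma inj_on_ptilde: "inj_on ptilde Nbar_space"
proof (rule inj_onI)
  fix z z' assume "z \<in> Nbar_space" "z' \<in> Nbar_space" and eq: "ptilde z = ptilde z'"
  then obtain t b t' b' where z: "z = Nbar_proj (t, orbit_of b)" "z' = Nbar_proj (t', orbit_of b')"
    by (metis Nbar_space_cases)
  have mem: "of_nat k dvd b \<and> near t k m \<longleftrightarrow> of_nat k dvd b' \<and> near t' k m" if "k \<noteq> 0" for k m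
  proof -
    have "(m, k) \<in> ptilde z \<longleftrightarrow> (m, k) \<in> ptilde z'"
      by (simp only: eq)
    then show ?thesis
      using that by (simp add: z ptilde_Nbar_proj)
  qed
  \<comment> \<open>By \<open>near_exists\<close>, every nonzero \<open>k\<close> dividing
    \<open>b\<close> does occur as a modulus.\<close>
  have "of_nat k dvd b \<longleftrightarrow> of_nat k dvd b'" if "k \<noteq> 0" for k
    using mem[OF that] near_exists[OF that] by metis
  then have "b dvd b'" "b' dvd b"
    by (blast intro: zhat_dvd_if_nat_divisors)+
  then have "orbit_of b = orbit_of b'"
    by (rule zhat_associated)
  moreover have near_eq: "near t k m \<longleftrightarrow> near t' k m" if "k \<noteq> 0" "of_nat k dvd b" for k m
    using mem[of k] near_exists[of k] that by metis
  have "Nbar_sim (t, orbit_of b) (t', orbit_of b)"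
  proof (cases t; cases t')
    fix n n' assume "t = Inl n" "t' = Inl n'"
    then have "(\<exists>j. n = m + j) \<longleftrightarrow> (\<exists>j. n' = m + j)" for m
      using near_eq[of 1 m] by simp
    then have "m \<le> n \<longleftrightarrow> m \<le> n'" for m
      by (simp add: le_iff_add)
    then have "n = n'"
      by (meson order_antisym order_refl)
    then show ?thesis
      using \<open>t = Inl n\<close> \<open>t' = Inl n'\<close> by simp
  next
    \<comment> \<open>At modulus 1 every natural is near a profinite point, whereas
      \<open>Suc n\<close> is not near \<open>Inl n\<close>.\<close>
    fix n s assume "t = Inl n" "t' = Inr s"
    then show ?thesis
      using near_eq[of 1 "Suc n"] by simp
  next
    fix n s assume "t = Inr s" "t' = Inl n"
    then show ?thesis
      using near_eq[of 1 "Suc n"] by simp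
  next
    fix s s' assume t: "t = Inr s" "t' = Inr s'"
    have "of_nat k dvd s - s'" if k: "k \<noteq> 0" "of_nat k dvd b" for k
    proof -
      obtain n where "near t k n"
        using near_exists[OF k(1)] ..
      then have "of_nat k dvd s - of_nat n" "of_nat k dvd s' - of_nat n"
        using near_eq[OF k] by (simp_all add: t)
      then have "of_nat k dvd (s - of_nat n) - (s' - of_nat n)"
        by (rule dvd_diff)
      then show ?thesis by simp
    qed
    then have "b dvd s - s'"
      by (rule zhat_dvd_if_nat_divisors)
    then show ?thesis
      by (simp add: t orbit_ideal.abs_eq zhat_ideal_iff)
  qed
  ultimately show "z = z'"
    by (simp add: z Nbar_proj_eq_iff)
qed

section \<open>The action computed on representatives\<close>

abbreviation affine :: "nat \<Rightarrow> nat \<Rightarrow> nat + zhat \<Rightarrow> nat + zhat" where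
  "affine m k \<equiv> map_sum (\<lambda>n. m + k * n) (\<lambda>s. of_nat m + of_nat k * s)"

lemma Nbar_proj_affine:
  assumes "Nbar_proj (t, a) = (r, a)"
  shows "Nbar_proj (affine m k t, orbit_scale k a) = (Nbar_add m (Nbar_scale k r), orbit_scale k a)"
  using assms
  by (cases t) (auto simp: Nbar_proj_def orbit_ideal_scale image_image algebra_simps)

lemma near_affine:
  assumes "near t j n"
  shows "near (affine m k t) (k * j) (m + k * n)"
proof (cases t)
  case (Inl r)
  then show ?thesis using assms by (auto simp: algebra_simps)
next
  case (Inr s)
  then have "of_nat k * of_nat j dvd of_nat k * (s - of_nat n)"
    using assms by (intro mult_dvd_mono) simp_all
  then show ?thesis using Inr by (simp add: algebra_simps)
qed

text \<open>The modulus \<open>j = l div gcd l k\<close> satisfies \<open>l dvd k * j\<close>, so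
  agreement of \<open>n'\<close> with \<open>t\<close> modulo \<open>j\<close> becomes agreement of
  \<open>m + k * n'\<close> with \<open>n\<close> modulo \<open>l\<close>.\<close>

lemma near_affine_lift:
  assumes "k \<noteq> 0" "l \<noteq> 0" and near: "near (affine m k t) l n"
  shows "\<exists>n'. near t (l div gcd l k) n' \<and> (\<exists>i. m + k * n' = n + l * i)"
proof (cases t)
  case (Inl r)
  then show ?thesis
    using near by (intro exI[of _ r]) auto
next
  case (Inr s)
  let ?j = "l div gcd l k"
  have "?j \<noteq> 0"
    using assms(2) by (simp add: dvd_div_eq_0_iff)
  then obtain n' where n': "n' \<ge> n" "of_nat ?j dvd s - of_nat n'"
    using zhat_approx_nat_ge by blast
  have "l dvd k * ?j"
    by (metis div_mult_swap dvd_triv_left gcd_dvd1 gcd_dvd2 mult.commute)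
  then have "of_nat l dvd (of_nat (k * ?j) :: zhat)"
    using of_nat_dvd_zhat_of_nat_iff[OF assms(2)] by blast
  also have "of_nat (k * ?j) dvd of_nat k * (s - of_nat n')"
    unfolding of_nat_mult by (rule mult_dvd_mono[OF dvd_refl n'(2)])
  finally have "of_nat l dvd of_nat k * (s - of_nat n')" .
  moreover have "of_nat l dvd of_nat m + of_nat k * s - of_nat n"
    using near by (simp only: Inr map_sum.simps near.simps)
  ultimately have "of_nat l dvd (of_nat m + of_nat k * s - of_nat n) - of_nat k * (s - of_nat n')"
    by (rule dvd_diff[rotated])
  moreover have le: "n \<le> m + k * n'"
    \<comment> \<open>As \<open>k\<close> is positive,
      \<open>n \<le> n' \<le> k * n'\<close>.\<close>
    using n'(1) assms(1) by (metis le_trans mult_le_mono1 mult_1 less_one linorder_not_less trans_le_add2)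
  then have "(of_nat m + of_nat k * s - of_nat n) - of_nat k * (s - of_nat n')
      = (of_nat (m + k * n' - n) :: zhat)"
    by (simp add: of_nat_diff algebra_simps)
  ultimately have "l dvd m + k * n' - n"
    using of_nat_dvd_zhat_of_nat_iff[OF assms(2)] by simp
  then obtain i where "m + k * n' - n = l * i" ..
  then have "m + k * n' = n + l * i"
    using le by simp
  then show ?thesis
    using n'(2) Inr by auto
qed

text \<open>The right-hand side contains the translated set, and each of its elements lies below a
  translated one, so every hereditary set containing the translate contains it.\<close>

lemma nica_act_ptilde:
  assumes k: "k \<noteq> 0"
  shows "nica_act (m, k) (ptilde (Nbar_proj (t, orbit_of b)))
    = ptilde (Nbar_proj (affine m k t, orbit_of (of_nat k * b)))" (is "nica_act _ ?w = ?v")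
proof -
  have "{(m, k) \<otimes>\<^bsub>NN\<^esub> y |y. y \<in> ?w} \<subseteq> ?v"
  proof
    fix x assume "x \<in> {(m, k) \<otimes>\<^bsub>NN\<^esub> y |y. y \<in> ?w}"
    then obtain n j where x: "x = (m + k * n, k * j)" and w: "(n, j) \<in> ?w"
      by (auto simp: semidirect_def)
    then show "x \<in> ?v"
      using k near_affine[of t j n m k] by (simp add: ptilde_Nbar_proj mult_dvd_mono)
  qed
  moreover have "?v \<in> nica_spectrum"
    by (intro ptilde_in_nica_spectrum Nbar_proj_in_Nbar_space)
  moreover have "?v \<subseteq> v"
    if v: "v \<in> nica_spectrum" and sub: "{(m, k) \<otimes>\<^bsub>NN\<^esub> y |y. y \<in> ?w} \<subseteq> v" for v
  proof
    fix x assume x: "x \<in> ?v"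
    obtain n l where xnl: "x = (n, l)"
      using surj_pair[of x] by blast
    with x have l: "l \<noteq> 0" "of_nat l dvd of_nat k * b" "near (affine m k t) l n"
      by (simp_all add: ptilde_Nbar_proj)
    let ?j = "l div gcd l k"
    obtain n' i where n': "near t ?j n'" "m + k * n' = n + l * i"
      using near_affine_lift[OF k l(1,3)] by blast
    have "?j \<noteq> 0"
      using l(1) by (simp add: dvd_div_eq_0_iff)
    then have "(n', ?j) \<in> ?w"
      using n'(1) zhat_dvd_mult_gcd[OF l(1,2)] by (simp add: ptilde_Nbar_proj)
    then have "(m, k) \<otimes>\<^bsub>NN\<^esub> (n', ?j) \<in> v"
      using sub by blast
    then have in_v: "(n + l * i, k * ?j) \<in> v"
      by (simp add: semidirect_def n'(2))
    \<comment> \<open>Both sides equal the lcm of \<open>k\<close> and \<open>l\<close>; the right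
      form exhibits it as a multiple of \<open>l\<close>.\<close>
    have "k * ?j = l * (k div gcd l k)"
      by (metis div_mult_swap gcd_dvd1 gcd_dvd2 mult.commute)
    moreover have "k * ?j \<noteq> 0"
      using k \<open>?j \<noteq> 0\<close> by simp
    ultimately have "NN_le (n, l) (n + l * i, k * ?j)"
      using NN_le_iff[OF l(1)] by blast
    moreover have "(n, l) \<in> carrier NN"
      using l(1) by (simp add: semidirect_def)
    ultimately show "x \<in> v"
      using v in_v by (auto simp: xnl nica_spectrum_def hereditary_def)
  qed
  ultimately show ?thesis
    unfolding nica_act_def by (intro Least_equality) auto
qed

text \<open>By injectivity of \<open>ptilde\<close>, it suffices that the claimed point lies in
  \<open>Nbar_space\<close> and that \<open>ptilde\<close> sends it to the set obtained from the
  action on the Nica spectrum.\<close>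

theorem proposition1p2:
  fixes m k :: nat and r :: "nat + zhat set" and a :: zhat_orbit
  assumes "(m, k) \<in> carrier NN" and "(r, a) \<in> Nbar_space"
  shows "Nbar_act (m, k) (r, a) = (Nbar_add m (Nbar_scale k r), orbit_scale k a)"
proof -
  obtain t b where "(r, a) = Nbar_proj (t, orbit_of b)"
    using assms(2) by (rule Nbar_space_cases)
  then have t: "Nbar_proj (t, orbit_of b) = (r, a)" and a: "a = orbit_of b"
    by (simp_all add: Nbar_proj_def)
  define z where "z = Nbar_proj (affine m k t, orbit_of (of_nat k * b))"
  have z: "z = (Nbar_add m (Nbar_scale k r), orbit_scale k a)"
    using Nbar_proj_affine[of t a r m k] t by (simp add: z_def a orbit_scale.abs_eq)
  have "k \<noteq> 0"
    using assms(1) by (simp add: semidirect_def)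
  then have "nica_act (m, k) (ptilde (r, a)) = ptilde z"
    using nica_act_ptilde[of k m t b] by (simp add: t z_def)
  moreover have "z \<in> Nbar_space"
    unfolding z_def by (rule Nbar_proj_in_Nbar_space)
  ultimately show ?thesis
    unfolding z[symmetric] Nbar_act_def by (simp add: the_inv_into_f_f inj_on_ptilde)
qed

end
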